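(* Let $c\in\mathbb{R}$, let $I\subset(0,\infty)$ and $J\subset\mathbb{R}$ be nonempty open intervals, let $z:I\to\mathbb{R}$ be smooth, and let $S_\gamma\subset\mathbb{I}^3$ be the helicoidal surface $$\mathbf r(t,\theta)=(t\cos\theta,\;t\sin\theta,\;c\,\theta+z(t)),\qquad (t,\theta)\in I\times J,$$ generated by $\gamma(t)=(t,0,z(t))$. If $S_\gamma$ is an isotropic singular minimal surface with respect to the plane $\Pi_{yz}=\{x=0\}$ or with respect to the plane $\Pi_{xy}=\{z=0\}$, then $c=0$, i.e. $S_\gamma$ is a surface of Euclidean revolution. In addition: 1. If the reference plane is $\Pi_{yz}$ (isotropic), then $z(t)=\dfrac{z_2}{t}+z_1$ for some $z_1,z_2\in\mathbb{R}$ (in particular, this includes horizontal planes). 2. If the reference plane is $\Pi_{xy}$ (non-isotropic), then $z=z(t)>0$ satisfies $$z''(t)+\frac{z'(t)}{t}=\frac{1-z'(t)^2}{2z(t)}.$$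
   Context: The simply isotropic space $\mathbb{I}^3$ is $\mathbb{R}^3$ with coordinates $(x,y,z)$, the degenerate metric $\langle\mathbf u,\mathbf v\rangle=u^1v^1+u^2v^2$, and the secondary metric $\langle\langle\mathbf u,\mathbf v\rangle\rangle=u^3v^3$. An admissible surface (no tangent plane contains the direction $(0,0,1)$) is locally a graph $(x,y,u(x,y))$; its mean curvature is $H=\frac{u_{xx}+u_{yy}}{2}$ and its parabolic normal is $\mathbf N_{par}=\left(-u_x,-u_y,\frac12-\frac{u_x^2+u_y^2}{2}\right)$. An admissible surface $M^2$ contained in the half-space $x>0$ is an isotropic singular minimal surface with respect to the isotropic plane $\Pi_{yz}=\{x=0\}$ if $H=\frac{\langle\mathbf N_{par},\partial_x\rangle}{2\,d(p,\Pi_{yz})}$ at every $p\in M^2$, where $d(p,\Pi_{yz})=x$. An admissible surface $M^2$ contained in the half-space $z>0$ is an isotropic singular minimal surface with respect to the non-isotropic plane $\Pi_{xy}=\{z=0\}$ if $H=\frac{\langle\langle\mathbf N_{par},\partial_z\rangle\rangle}{2\,d(p,\Pi_{xy})}$ at every $p\in M^2$, where $d(p,\Pi_{xy})=z$. *)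

theory Defs
  imports "HOL-Analysis.Analysis"
begin

definition dir_deriv ::
  "('a::real_normed_vector \<Rightarrow> 'b::real_normed_vector) \<Rightarrow> 'a \<Rightarrow> 'a \<Rightarrow> 'b" where
  "dir_deriv f v = (\<lambda>p. frechet_derivative f (at p) v)"

primrec Ck_on ::
  "nat \<Rightarrow> 'a::euclidean_space set \<Rightarrow> ('a \<Rightarrow> 'b::real_normed_vector) \<Rightarrow> bool" where
  "Ck_on 0 U f \<longleftrightarrow> continuous_on U f"
| "Ck_on (Suc k) U f \<longleftrightarrow>
     (\<forall>p\<in>U. f differentiable (at p)) \<and> (\<forall>v\<in>Basis. Ck_on k U (dir_deriv f v))"

text \<open>Derivatives are taken in the whole space, so \<open>U\<close> should be open.\<close>
definition smooth_on ::
  "'a::euclidean_space set \<Rightarrow> ('a \<Rightarrow> 'b::real_normed_vector) \<Rightarrow> bool" where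
  "smooth_on U f \<longleftrightarrow> (\<forall>k. Ck_on k U f)"

definition iso_metric :: "real^3 \<Rightarrow> real^3 \<Rightarrow> real" where
  "iso_metric u v = u $ 1 * v $ 1 + u $ 2 * v $ 2"

definition iso_metric2 :: "real^3 \<Rightarrow> real^3 \<Rightarrow> real" where
  "iso_metric2 u v = u $ 3 * v $ 3"

text \<open>Regular parametrized surface \<open>r\<close> over \<open>D\<close> whose tangent planes
  (the ranges of the differentials) do not contain the isotropic direction.\<close>
definition admissible_surface :: "(real \<times> real \<Rightarrow> real^3) \<Rightarrow> (real \<times> real) set \<Rightarrow> bool" where
  "admissible_surface r D \<longleftrightarrow>
     open D \<and> smooth_on D r \<and>
     (\<forall>q\<in>D. inj (frechet_derivative r (at q)) \<and>
            axis 3 1 \<notin> range (frechet_derivative r (at q)))"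

definition graph_map :: "(real \<times> real \<Rightarrow> real) \<Rightarrow> real \<times> real \<Rightarrow> real^3" where
  "graph_map u = (\<lambda>(x, y). vector [x, y, u (x, y)])"

text \<open>Near the parameter \<open>q\<close>, the surface is the graph of \<open>u\<close>. Working with a neighbourhood
  of the parameter, rather than of the image point, allows for surfaces with self-intersections.\<close>
definition local_graph ::
  "(real \<times> real \<Rightarrow> real^3) \<Rightarrow> (real \<times> real) set \<Rightarrow> real \<times> real \<Rightarrow> (real \<times> real \<Rightarrow> real) \<Rightarrow> bool" where
  "local_graph r D q u \<longleftrightarrow>
     (\<exists>V U. open V \<and> q \<in> V \<and> V \<subseteq> D \<and> open U \<and> smooth_on U u \<and> r ` V = graph_map u ` U)"

definition iso_mean_curvature :: "(real \<times> real \<Rightarrow> real) \<Rightarrow> real \<times> real \<Rightarrow> real" where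
  "iso_mean_curvature u p =
     (dir_deriv (dir_deriv u (1, 0)) (1, 0) p + dir_deriv (dir_deriv u (0, 1)) (0, 1) p) / 2"

definition parabolic_normal :: "(real \<times> real \<Rightarrow> real) \<Rightarrow> real \<times> real \<Rightarrow> real^3" where
  "parabolic_normal u p =
     vector [- dir_deriv u (1, 0) p, - dir_deriv u (0, 1) p,
             1/2 - ((dir_deriv u (1, 0) p)\<^sup>2 + (dir_deriv u (0, 1) p)\<^sup>2) / 2]"

text \<open>Distances of a point to the planes \<open>x = 0\<close> and \<open>z = 0\<close>, for points
  in the half-spaces \<open>x > 0\<close> and \<open>z > 0\<close> respectively.\<close>
definition dist_yz :: "real^3 \<Rightarrow> real" where
  "dist_yz p = p $ 1"

definition dist_xy :: "real^3 \<Rightarrow> real" where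
  "dist_xy p = p $ 3"

text \<open>For an admissible surface a local graph function exists at every parameter and its germ
  there is unique, so the existential quantifier over \<open>u\<close> just names this germ.\<close>
definition singular_minimal_yz :: "(real \<times> real \<Rightarrow> real^3) \<Rightarrow> (real \<times> real) set \<Rightarrow> bool" where
  "singular_minimal_yz r D \<longleftrightarrow>
     admissible_surface r D \<and> (\<forall>q\<in>D. r q $ 1 > 0) \<and>
     (\<forall>q\<in>D. \<exists>u. local_graph r D q u \<and>
        iso_mean_curvature u (r q $ 1, r q $ 2) =
          iso_metric (parabolic_normal u (r q $ 1, r q $ 2)) (axis 1 1) / (2 * dist_yz (r q)))"

definition singular_minimal_xy :: "(real \<times> real \<Rightarrow> real^3) \<Rightarrow> (real \<times> real) set \<Rightarrow> bool" where
  "singular_minimal_xy r D \<longleftrightarrow>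
     admissible_surface r D \<and> (\<forall>q\<in>D. r q $ 3 > 0) \<and>
     (\<forall>q\<in>D. \<exists>u. local_graph r D q u \<and>
        iso_mean_curvature u (r q $ 1, r q $ 2) =
          iso_metric2 (parabolic_normal u (r q $ 1, r q $ 2)) (axis 3 1) / (2 * dist_xy (r q)))"

definition generating_curve :: "(real \<Rightarrow> real) \<Rightarrow> real \<Rightarrow> real^3" where
  "generating_curve z t = vector [t, 0, z t]"

definition helicoidal_surface :: "real \<Rightarrow> (real \<Rightarrow> real) \<Rightarrow> real \<times> real \<Rightarrow> real^3" where
  "helicoidal_surface c z = (\<lambda>(t, \<theta>). vector [t * cos \<theta>, t * sin \<theta>, c * \<theta> + z t])"

definition rot_z :: "real \<Rightarrow> real^3 \<Rightarrow> real^3" where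
  "rot_z \<theta> p = vector [cos \<theta> * p $ 1 - sin \<theta> * p $ 2, sin \<theta> * p $ 1 + cos \<theta> * p $ 2, p $ 3]"

definition is_revolution_surface ::
  "(real \<times> real \<Rightarrow> real^3) \<Rightarrow> (real \<Rightarrow> real^3) \<Rightarrow> real set \<Rightarrow> real set \<Rightarrow> bool" where
  "is_revolution_surface r \<gamma> I J \<longleftrightarrow> (\<forall>t\<in>I. \<forall>\<theta>\<in>J. r (t, \<theta>) = rot_z \<theta> (\<gamma> t))"

end

theory Submission
  imports Defs
begin

text \<open>A local graph function \<open>u\<close> satisfies \<open>u (t cos \<theta>, t sin \<theta>) = c \<theta> + z t\<close>. Differentiating
  this in polar coordinates gives \<open>u\<^sub>x\<close> and \<open>u\<^sub>y\<close>, and \<open>u\<^sub>x\<^sub>x + u\<^sub>y\<^sub>y = z'' + z'/t\<close>. The singular minimality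
  equation then becomes an identity on \<open>I \<times> J\<close> in which \<open>\<theta>\<close> occurs only in a term with factor \<open>c\<close>:
  \<open>z'' + z'/t = - z'/t + c tan \<theta> / t\<^sup>2\<close> for the isotropic plane, and
  \<open>2 (z'' + z'/t) (c \<theta> + z) = 1 - z'\<^sup>2 - c\<^sup>2/t\<^sup>2\<close> for the other one. Comparing two values of \<open>\<theta>\<close>
  forces \<open>c = 0\<close> in the first case. In the second case \<open>c \<noteq> 0\<close> would give \<open>z'' + z'/t = 0\<close> and
  \<open>z'\<^sup>2 + c\<^sup>2/t\<^sup>2 = 1\<close>, and the derivative of the latter contradicts the former.\<close>

section \<open>Derivatives of smooth functions\<close>

lemma has_derivative_dir_deriv:
  "f differentiable at p \<Longrightarrow> (f has_derivative (\<lambda>v. dir_deriv f v p)) (at p)"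
  unfolding dir_deriv_def using frechet_derivative_works by blast

lemma smooth_on_differentiable:
  "smooth_on U f \<Longrightarrow> p \<in> U \<Longrightarrow> f differentiable at p"
  unfolding smooth_on_def by (metis Ck_on.simps(2))

lemma smooth_on_dir_deriv:
  "smooth_on U f \<Longrightarrow> v \<in> Basis \<Longrightarrow> smooth_on U (dir_deriv f v)"
  unfolding smooth_on_def by (metis Ck_on.simps(2))

lemma smooth_on_has_deriv:
  fixes f :: "real \<Rightarrow> real"
  assumes "smooth_on S f" "t \<in> S"
  shows "(f has_real_derivative deriv f t) (at t)"
  using smooth_on_differentiable[OF assms]
  by (metis DERIV_imp_deriv real_differentiable_def)

text \<open>\<open>smooth_on\<close> speaks of iterated \<open>dir_deriv\<close>, which agrees with
  \<open>deriv\<close> only on \<open>S\<close>. Since \<open>S\<close> is open, agreement there is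
  enough to carry differentiability over to \<open>deriv f\<close>.\<close>

lemma smooth_on_has_deriv2:
  fixes f :: "real \<Rightarrow> real"
  assumes "open S" "smooth_on S f" "t \<in> S"
  shows "(deriv f has_real_derivative deriv (deriv f) t) (at t)"
proof -
  have eq: "dir_deriv f 1 s = deriv f s" if "s \<in> S" for s
    using fun_cong[OF has_derivative_unique[OF
        has_derivative_dir_deriv[OF smooth_on_differentiable[OF assms(2) that]]
        smooth_on_has_deriv[OF assms(2) that, unfolded has_field_derivative_def]], of 1]
    by simp
  have "smooth_on S (dir_deriv f 1)"
    using smooth_on_dir_deriv[OF assms(2)] by simp
  then obtain D where "(dir_deriv f 1 has_real_derivative D) (at t)"
    using smooth_on_has_deriv assms(3) by blast
  then have "(deriv f has_real_derivative D) (at t)"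
    by (rule has_field_derivative_transform_within_open[OF _ assms(1,3)]) (simp add: eq)
  then show ?thesis
    by (metis DERIV_imp_deriv)
qed

section \<open>Gradient and mean curvature in polar coordinates\<close>

text \<open>The chain rule expresses \<open>Ws\<close> and \<open>W\<phi> / s\<close> as the
  Cartesian partials rotated by the angle \<open>\<phi>\<close>; undoing the rotation gives the
  formulas. The function \<open>w\<close> is general because the lemma serves both for a graph
  function and for its partials.\<close>

lemma polar_partials:
  fixes w :: "real \<times> real \<Rightarrow> real"
  assumes w: "w differentiable at (s * cos \<phi>, s * sin \<phi>)" and "s > 0"
    and V: "open V" "(s, \<phi>) \<in> V"
    and eq: "\<And>a b. (a, b) \<in> V \<Longrightarrow> w (a * cos b, a * sin b) = W a b"
    and Ws: "((\<lambda>a. W a \<phi>) has_real_derivative Ws) (at s)"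
    and W\<phi>: "((\<lambda>b. W s b) has_real_derivative W\<phi>) (at \<phi>)"
  shows "dir_deriv w (1, 0) (s * cos \<phi>, s * sin \<phi>) = Ws * cos \<phi> - W\<phi> * sin \<phi> / s"
    and "dir_deriv w (0, 1) (s * cos \<phi>, s * sin \<phi>) = Ws * sin \<phi> + W\<phi> * cos \<phi> / s"
proof -
  define L where "L v = dir_deriv w v (s * cos \<phi>, s * sin \<phi>)" for v
  have L: "(w has_derivative L) (at (s * cos \<phi>, s * sin \<phi>))"
    using has_derivative_dir_deriv[OF w] by (simp add: L_def[abs_def])
  interpret L: linear L using has_derivative_linear[OF L] .
  have Lxy: "L (x, y) = x * L (1, 0) + y * L (0, 1)" for x y
  proof -
    have "L (x, y) = L (x *\<^sub>R (1, 0) + y *\<^sub>R (0, 1))" by simp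
    then show ?thesis by (simp only: L.add L.scaleR) simp
  qed
  \<comment> \<open>A box inside \<open>V\<close> lets one polar coordinate vary while the other
    stays fixed, so \<open>eq\<close> holds along both coordinate curves.\<close>
  obtain A B where AB: "open A" "open B" "s \<in> A" "\<phi> \<in> B" "A \<times> B \<subseteq> V"
    by (rule open_prod_elim[OF V]) (use that in auto)
  have "((\<lambda>a. w (a * cos \<phi>, a * sin \<phi>)) has_derivative (\<lambda>h. L (h * cos \<phi>, h * sin \<phi>))) (at s)"
    by (rule has_derivative_compose[where f = "\<lambda>a. (a * cos \<phi>, a * sin \<phi>)", OF _ L])
      (auto intro!: derivative_eq_intros)
  then have "((\<lambda>a. W a \<phi>) has_derivative (\<lambda>h. L (h * cos \<phi>, h * sin \<phi>))) (at s)"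
    by (rule has_derivative_transform_within_open[OF _ AB(1,3)]) (use AB eq in auto)
  then have 1: "L (cos \<phi>, sin \<phi>) = Ws"
    using fun_cong[OF has_derivative_unique[OF _ Ws[unfolded has_field_derivative_def]], of _ 1]
    by simp
  have "((\<lambda>b. w (s * cos b, s * sin b)) has_derivative
      (\<lambda>h. L (h * (- s * sin \<phi>), h * (s * cos \<phi>)))) (at \<phi>)"
    by (rule has_derivative_compose[where f = "\<lambda>b. (s * cos b, s * sin b)", OF _ L])
      (auto intro!: derivative_eq_intros)
  then have "((\<lambda>b. W s b) has_derivative (\<lambda>h. L (h * (- s * sin \<phi>), h * (s * cos \<phi>)))) (at \<phi>)"
    by (rule has_derivative_transform_within_open[OF _ AB(2,4)]) (use AB eq in auto)
  then have 2: "L (- s * sin \<phi>, s * cos \<phi>) = W\<phi>"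
    using fun_cong[OF has_derivative_unique[OF _ W\<phi>[unfolded has_field_derivative_def]], of _ 1]
    by simp
  have Ws': "Ws = cos \<phi> * L (1, 0) + sin \<phi> * L (0, 1)"
    using 1 Lxy by metis
  have "W\<phi> = s * (cos \<phi> * L (0, 1) - sin \<phi> * L (1, 0))"
    using 2 Lxy[of "- s * sin \<phi>" "s * cos \<phi>"] by (simp add: algebra_simps)
  then have W\<phi>': "W\<phi> / s = cos \<phi> * L (0, 1) - sin \<phi> * L (1, 0)"
    using \<open>s > 0\<close> by simp
  have sc: "(sin \<phi>)\<^sup>2 + (cos \<phi>)\<^sup>2 = 1" by simp
  have "Ws * cos \<phi> - (W\<phi> / s) * sin \<phi> = L (1, 0)"
    unfolding Ws' W\<phi>' using sc by algebra
  then show "dir_deriv w (1, 0) (s * cos \<phi>, s * sin \<phi>) = Ws * cos \<phi> - W\<phi> * sin \<phi> / s"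
    by (simp add: L_def)
  have "Ws * sin \<phi> + (W\<phi> / s) * cos \<phi> = L (0, 1)"
    unfolding Ws' W\<phi>' using sc by algebra
  then show "dir_deriv w (0, 1) (s * cos \<phi>, s * sin \<phi>) = Ws * sin \<phi> + W\<phi> * cos \<phi> / s"
    by (simp add: L_def)
qed

text \<open>Two rounds of \<open>polar_partials\<close>: first for \<open>u\<close>, then for its
  partials, whose polar form is known on the whole neighbourhood \<open>V\<close> from the first
  round.\<close>

lemma local_graph_helicoidal:
  fixes c :: real
  assumes "open I" "I \<subseteq> {0<..}" "smooth_on I z" "t \<in> I" "\<theta> \<in> J"
    and lg: "local_graph (helicoidal_surface c z) (I \<times> J) (t, \<theta>) u"
  defines "p \<equiv> (t * cos \<theta>, t * sin \<theta>)"
  shows "dir_deriv u (1, 0) p = deriv z t * cos \<theta> - c * sin \<theta> / t"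
    and "dir_deriv u (0, 1) p = deriv z t * sin \<theta> + c * cos \<theta> / t"
    and "2 * iso_mean_curvature u p = deriv (deriv z) t + deriv z t / t"
proof -
  obtain V U where V: "open V" "(t, \<theta>) \<in> V" "V \<subseteq> I \<times> J" and u: "smooth_on U u"
    and img: "helicoidal_surface c z ` V = graph_map u ` U"
    using lg unfolding local_graph_def by blast
  have graph: "(a * cos b, a * sin b) \<in> U \<and> u (a * cos b, a * sin b) = c * b + z a"
    if "(a, b) \<in> V" for a b
  \<comment> \<open>Equality of images suffices: the first two coordinates of a graph point
    determine its base point, so the third one must be the value of \<open>u\<close> there.\<close>
  proof -
    have "helicoidal_surface c z (a, b) \<in> graph_map u ` U"
      using that img by blast
    then obtain x y where xy: "(x, y) \<in> U" "helicoidal_surface c z (a, b) = graph_map u (x, y)"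
      by auto
    from xy(2) have "x = a * cos b" "y = a * sin b" "u (x, y) = c * b + z a"
      unfolding helicoidal_surface_def graph_map_def case_prod_conv
      by (metis vector_3)+
    with xy(1) show ?thesis by simp
  qed
  have d1: "u differentiable at (a * cos b, a * sin b)"
    and d2: "dir_deriv u (1, 0) differentiable at (a * cos b, a * sin b)"
    and d3: "dir_deriv u (0, 1) differentiable at (a * cos b, a * sin b)"
    if "(a, b) \<in> V" for a b
  proof -
    have "(1, 0) \<in> (Basis :: (real \<times> real) set)" "(0, 1) \<in> (Basis :: (real \<times> real) set)"
      by (auto simp: Basis_prod_def)
    note diff = smooth_on_differentiable[OF _ conjunct1[OF graph[OF that]]]
    show "u differentiable at (a * cos b, a * sin b)"
      by (rule diff[OF u])
    show "dir_deriv u (1, 0) differentiable at (a * cos b, a * sin b)"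
      by (rule diff[OF smooth_on_dir_deriv[OF u]]) fact
    show "dir_deriv u (0, 1) differentiable at (a * cos b, a * sin b)"
      by (rule diff[OF smooth_on_dir_deriv[OF u]]) fact
  qed
  have grad: "dir_deriv u (1, 0) (a * cos b, a * sin b) = deriv z a * cos b - c * sin b / a"
    "dir_deriv u (0, 1) (a * cos b, a * sin b) = deriv z a * sin b + c * cos b / a"
    if ab: "(a, b) \<in> V" for a b
  proof -
    have a: "a \<in> I" "a > 0" using ab V(3) assms(2) by auto
    have "((\<lambda>s. c * b + z s) has_real_derivative deriv z a) (at a)"
      by (auto intro!: derivative_eq_intros smooth_on_has_deriv[OF assms(3) a(1)])
    moreover have "((\<lambda>b. c * b + z a) has_real_derivative c) (at b)"
      by (auto intro!: derivative_eq_intros)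
    ultimately show "dir_deriv u (1, 0) (a * cos b, a * sin b) = deriv z a * cos b - c * sin b / a"
      "dir_deriv u (0, 1) (a * cos b, a * sin b) = deriv z a * sin b + c * cos b / a"
      using polar_partials[OF d1[OF ab] a(2) V(1) ab, of "\<lambda>a b. c * b + z a"] graph by blast+
  qed
  show "dir_deriv u (1, 0) p = deriv z t * cos \<theta> - c * sin \<theta> / t"
    and "dir_deriv u (0, 1) p = deriv z t * sin \<theta> + c * cos \<theta> / t"
    using grad[OF V(2)] by (simp_all add: p_def)
  have t: "t > 0" using assms by auto
  note z2 = smooth_on_has_deriv2[OF assms(1,3,4)]
  have xx: "dir_deriv (dir_deriv u (1, 0)) (1, 0) p =
      (deriv (deriv z) t * cos \<theta> + c * sin \<theta> / t\<^sup>2) * cos \<theta>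
        - (- deriv z t * sin \<theta> - c * cos \<theta> / t) * sin \<theta> / t"
    unfolding p_def
  proof (rule polar_partials(1)[OF d2[OF V(2)] t V(1,2) grad(1)])
    show "((\<lambda>a. deriv z a * cos \<theta> - c * sin \<theta> / a) has_real_derivative
        deriv (deriv z) t * cos \<theta> + c * sin \<theta> / t\<^sup>2) (at t)"
      using t by (auto intro!: derivative_eq_intros z2 simp: power2_eq_square)
    show "((\<lambda>b. deriv z t * cos b - c * sin b / t) has_real_derivative
        - deriv z t * sin \<theta> - c * cos \<theta> / t) (at \<theta>)"
      using t by (auto intro!: derivative_eq_intros)
  qed
  have yy: "dir_deriv (dir_deriv u (0, 1)) (0, 1) p =
      (deriv (deriv z) t * sin \<theta> - c * cos \<theta> / t\<^sup>2) * sin \<theta>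
        + (deriv z t * cos \<theta> - c * sin \<theta> / t) * cos \<theta> / t"
    unfolding p_def
  proof (rule polar_partials(2)[OF d3[OF V(2)] t V(1,2) grad(2)])
    show "((\<lambda>a. deriv z a * sin \<theta> + c * cos \<theta> / a) has_real_derivative
        deriv (deriv z) t * sin \<theta> - c * cos \<theta> / t\<^sup>2) (at t)"
      using t by (auto intro!: derivative_eq_intros z2 simp: power2_eq_square)
    show "((\<lambda>b. deriv z t * sin b + c * cos b / t) has_real_derivative
        deriv z t * cos \<theta> - c * sin \<theta> / t) (at \<theta>)"
      using t by (auto intro!: derivative_eq_intros)
  qed
  have mean: "2 * iso_mean_curvature u p
      = dir_deriv (dir_deriv u (1, 0)) (1, 0) p + dir_deriv (dir_deriv u (0, 1)) (0, 1) p"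
    by (simp add: iso_mean_curvature_def)
  \<comment> \<open>Here \<open>A\<close>, \<open>B\<close>, \<open>C\<close>, \<open>S\<close>
    stand for z'', z', cos and sin. The terms in \<open>c\<close> cancel because the polar angle is
    harmonic.\<close>
  have "(A * C + c * S / t\<^sup>2) * C - (- B * S - c * C / t) * S / t +
      ((A * S - c * C / t\<^sup>2) * S + (B * C - c * S / t) * C / t) = (A + B / t) * (S\<^sup>2 + C\<^sup>2)"
    for A B C S
    by (simp add: algebra_simps add_divide_distrib diff_divide_distrib power2_eq_square)
  then have "2 * iso_mean_curvature u p
      = (deriv (deriv z) t + deriv z t / t) * ((sin \<theta>)\<^sup>2 + (cos \<theta>)\<^sup>2)"
    unfolding mean xx yy .
  then show "2 * iso_mean_curvature u p = deriv (deriv z) t + deriv z t / t"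
    by simp
qed

section \<open>The singular minimality equations of a helicoidal surface\<close>

lemma singular_minimal_yz_helicoidal:
  assumes "open I" "I \<subseteq> {0<..}" "smooth_on I z" "t \<in> I" "\<theta> \<in> J"
    and sm: "singular_minimal_yz (helicoidal_surface c z) (I \<times> J)"
  shows "(deriv (deriv z) t + 2 * deriv z t / t) * cos \<theta> = c / t\<^sup>2 * sin \<theta>"
proof -
  let ?r = "helicoidal_surface c z (t, \<theta>)" and ?p = "(t * cos \<theta>, t * sin \<theta>)"
  have r: "?r $ 1 = t * cos \<theta>" "?r $ 2 = t * sin \<theta>"
    by (simp_all add: helicoidal_surface_def)
  obtain u where u: "local_graph (helicoidal_surface c z) (I \<times> J) (t, \<theta>) u"
    and eq: "iso_mean_curvature u ?p =
          iso_metric (parabolic_normal u ?p) (axis 1 1) / (2 * dist_yz ?r)"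
    using sm assms(4,5) unfolding singular_minimal_yz_def r[symmetric] by blast
  note g = local_graph_helicoidal[OF assms(1-5) u]
  have t: "t > 0" using assms by auto
  \<comment> \<open>The half-space condition makes cos positive, so the tangent of the angle is
    defined and the final equation can be cleared of its denominator.\<close>
  have "t * cos \<theta> > 0"
    using sm assms(4,5) unfolding singular_minimal_yz_def r[symmetric] by blast
  then have cos: "cos \<theta> > 0" using t by (simp add: zero_less_mult_iff)
  have "iso_metric (parabolic_normal u ?p) (axis 1 1) = - (deriv z t * cos \<theta> - c * sin \<theta> / t)"
    unfolding g(1)[symmetric] by (simp add: iso_metric_def parabolic_normal_def axis_def)
  moreover have "2 * (x / (2 * y)) = x / y" for x y :: real
    by simp
  ultimately have "deriv (deriv z) t + deriv z t / t =
      - (deriv z t * cos \<theta> - c * sin \<theta> / t) / (t * cos \<theta>)"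
    using eq g(3) unfolding dist_yz_def r by metis
  also have "\<dots> = c * sin \<theta> / (t\<^sup>2 * cos \<theta>) - deriv z t / t"
    using t cos by (simp add: diff_divide_distrib power2_eq_square)
  finally have "deriv (deriv z) t + 2 * deriv z t / t = c * sin \<theta> / (t\<^sup>2 * cos \<theta>)"
    by simp
  then show ?thesis
    using t cos by simp
qed

lemma singular_minimal_xy_helicoidal:
  assumes "open I" "I \<subseteq> {0<..}" "smooth_on I z" "t \<in> I" "\<theta> \<in> J"
    and sm: "singular_minimal_xy (helicoidal_surface c z) (I \<times> J)"
  shows "c * \<theta> + z t > 0"
    and "2 * (deriv (deriv z) t + deriv z t / t) * (c * \<theta> + z t) = 1 - (deriv z t)\<^sup>2 - c\<^sup>2 / t\<^sup>2"
proof -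
  let ?r = "helicoidal_surface c z (t, \<theta>)" and ?p = "(t * cos \<theta>, t * sin \<theta>)"
  have r: "?r $ 1 = t * cos \<theta>" "?r $ 2 = t * sin \<theta>" "?r $ 3 = c * \<theta> + z t"
    by (simp_all add: helicoidal_surface_def)
  obtain u where u: "local_graph (helicoidal_surface c z) (I \<times> J) (t, \<theta>) u"
    and eq: "iso_mean_curvature u ?p =
          iso_metric2 (parabolic_normal u ?p) (axis 3 1) / (2 * dist_xy ?r)"
    using sm assms(4,5) unfolding singular_minimal_xy_def r[symmetric] by blast
  note g = local_graph_helicoidal[OF assms(1-5) u]
  have t: "t > 0" using assms by auto
  show pos: "c * \<theta> + z t > 0"
    using sm assms(4,5) unfolding singular_minimal_xy_def r[symmetric] by blast
  \<comment> \<open>The gradient is the vector (z', c/t) rotated by \<open>\<theta>\<close>, so its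
    squared length does not depend on the angle.\<close>
  have "(B * C - c * S / t)\<^sup>2 + (B * S + c * C / t)\<^sup>2 = (B\<^sup>2 + (c / t)\<^sup>2) * (S\<^sup>2 + C\<^sup>2)" for B C S
    using t by (simp add: field_simps power2_eq_square)
  then have "(dir_deriv u (1, 0) ?p)\<^sup>2 + (dir_deriv u (0, 1) ?p)\<^sup>2
      = ((deriv z t)\<^sup>2 + (c / t)\<^sup>2) * ((sin \<theta>)\<^sup>2 + (cos \<theta>)\<^sup>2)"
    unfolding g(1,2) .
  then have "(dir_deriv u (1, 0) ?p)\<^sup>2 + (dir_deriv u (0, 1) ?p)\<^sup>2 = (deriv z t)\<^sup>2 + c\<^sup>2 / t\<^sup>2"
    by (simp add: power_divide)
  moreover have "iso_metric2 (parabolic_normal u ?p) (axis 3 1)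
      = (1 - ((dir_deriv u (1, 0) ?p)\<^sup>2 + (dir_deriv u (0, 1) ?p)\<^sup>2)) / 2"
    by (simp add: iso_metric2_def parabolic_normal_def axis_def field_simps)
  ultimately have "deriv (deriv z) t + deriv z t / t =
      (1 - ((deriv z t)\<^sup>2 + c\<^sup>2 / t\<^sup>2)) / (2 * (c * \<theta> + z t))"
    unfolding g(3)[symmetric] eq dist_xy_def r by simp
  then show "2 * (deriv (deriv z) t + deriv z t / t) * (c * \<theta> + z t)
      = 1 - (deriv z t)\<^sup>2 - c\<^sup>2 / t\<^sup>2"
    using pos by (simp only: eq_divide_eq) (simp add: algebra_simps add_divide_distrib)
qed

section \<open>Vanishing of the pitch\<close>

text \<open>The gap below \<open>pi\<close> ensures \<open>sin (b - a) > 0\<close>.\<close>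

lemma open_nearby:
  fixes J :: "real set"
  assumes "open J" "J \<noteq> {}"
  obtains a b where "a \<in> J" "b \<in> J" "a < b" "b < a + pi"
proof -
  obtain a e where a: "a \<in> J" and e: "e > 0" "ball a e \<subseteq> J"
    using assms by (meson ex_in_conv openE)
  \<comment> \<open>Half the radius stays inside the ball, and the cap 1 keeps the gap below
    \<open>pi\<close>.\<close>
  have "a + min (e / 2) 1 \<in> ball a e"
    using e(1) by (simp add: dist_real_def)
  with that[of a "a + min (e / 2) 1"] show thesis
    using a e pi_gt3 by (auto simp: min_def split: if_splits)
qed

text \<open>The coefficient of cos in \<open>eq\<close> is the same at both angles; eliminating it
  leaves \<open>c / t\<^sup>2 * sin (b - a) = 0\<close>.\<close>

lemma singular_minimal_yz_pitch_zero:
  assumes "open I" "I \<noteq> {}" "I \<subseteq> {0<..}" "open J" "J \<noteq> {}" "smooth_on I z"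
    and sm: "singular_minimal_yz (helicoidal_surface c z) (I \<times> J)"
  shows "c = 0"
proof -
  obtain t where t: "t \<in> I" using assms(2) by blast
  obtain a b where ab: "a \<in> J" "b \<in> J" "a < b" "b < a + pi"
    using open_nearby[OF assms(4,5)] .
  note eq = singular_minimal_yz_helicoidal[OF assms(1,3,6) t _ sm]
  have "c / t\<^sup>2 * sin (b - a) = (c / t\<^sup>2 * sin b) * cos a - (c / t\<^sup>2 * sin a) * cos b"
    by (simp add: sin_diff algebra_simps)
  also have "\<dots> = 0"
    unfolding eq[OF ab(1), symmetric] eq[OF ab(2), symmetric] by simp
  finally show "c = 0"
    using sin_gt_zero[of "b - a"] ab t assms(3) by auto
qed

lemma singular_minimal_xy_pitch_zero:
  assumes "open I" "I \<noteq> {}" "I \<subseteq> {0<..}" "open J" "J \<noteq> {}" "smooth_on I z"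
    and sm: "singular_minimal_xy (helicoidal_surface c z) (I \<times> J)"
  shows "c = 0"
proof (rule ccontr)
  assume c: "c \<noteq> 0"
  obtain a b where ab: "a \<in> J" "b \<in> J" "a < b"
    using open_nearby[OF assms(4,5)] by metis
  note eq = singular_minimal_xy_helicoidal(2)[OF assms(1,3,6) _ _ sm]
  have harm: "deriv (deriv z) t + deriv z t / t = 0" if "t \<in> I" for t
  proof -
    define K where "K = deriv (deriv z) t + deriv z t / t"
    have "2 * K * (c * a + z t) = 2 * K * (c * b + z t)"
      using eq[OF that ab(1)] eq[OF that ab(2)] unfolding K_def by simp
    \<comment> \<open>The left side of \<open>eq\<close> is affine in the angle with slope
      \<open>2 * K * c\<close>, while the right side is independent of it.\<close>
    then have "K * (c * (b - a)) = 0" by auto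
    then show ?thesis using c ab(3) by (simp add: K_def)
  qed
  have norm: "(deriv z t)\<^sup>2 + c\<^sup>2 / t\<^sup>2 = 1" if "t \<in> I" for t
    using eq[OF that ab(1)] harm[OF that] by simp
  obtain t where t: "t \<in> I" using assms(2) by blast
  then have "t > 0" using assms(3) by auto
  have "((\<lambda>t. (deriv z t)\<^sup>2 + c\<^sup>2 / t\<^sup>2) has_real_derivative
      2 * deriv z t * deriv (deriv z) t - 2 * c\<^sup>2 / t ^ 3) (at t)"
    using \<open>t > 0\<close>
    by (auto intro!: derivative_eq_intros smooth_on_has_deriv2[OF assms(1,6) t]
        simp: power2_eq_square power3_eq_cube field_simps)
  moreover have "((\<lambda>t. (deriv z t)\<^sup>2 + c\<^sup>2 / t\<^sup>2) has_real_derivative 0) (at t)"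
    by (rule has_field_derivative_transform_within_open[OF DERIV_const[of 1] assms(1) t])
      (simp add: norm)
  ultimately have "2 * deriv z t * deriv (deriv z) t - 2 * c\<^sup>2 / t ^ 3 = 0"
    by (rule DERIV_unique)
  moreover have "deriv (deriv z) t = - deriv z t / t"
    using harm[OF t] by simp
  \<comment> \<open>After substitution the derivative is -2/t times the very quantity that
    \<open>norm\<close> sets equal to 1.\<close>
  ultimately have "(deriv z t)\<^sup>2 + c\<^sup>2 / t\<^sup>2 = 0"
    using \<open>t > 0\<close> by (simp add: power2_eq_square power3_eq_cube field_simps)
  then show False using norm[OF t] by simp
qed

text \<open>The integrating factor \<open>t\<^sup>2\<close> turns the equation into (t^2 z')' = 0.
  Thus t^2 z' is a constant \<open>k\<close>, and then z + k/t is constant too; both steps rely on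
  \<open>I\<close> being an interval.\<close>

lemma radial_harmonic_solution:
  fixes z :: "real \<Rightarrow> real"
  assumes "open I" "is_interval I" "I \<noteq> {}" "I \<subseteq> {0<..}" "smooth_on I z"
    and ode: "\<And>t. t \<in> I \<Longrightarrow> deriv (deriv z) t + 2 * deriv z t / t = 0"
  shows "\<exists>z1 z2. \<forall>t\<in>I. z t = z2 / t + z1"
proof -
  have I: "convex I" using assms(2) is_interval_convex by blast
  have pos: "t > 0" if "t \<in> I" for t using that assms(4) by auto
  have "((\<lambda>t. t\<^sup>2 * deriv z t) has_real_derivative 0) (at t within I)" if t: "t \<in> I" for t
  proof -
    have "((\<lambda>t. t\<^sup>2 * deriv z t) has_real_derivative
        t\<^sup>2 * (deriv (deriv z) t + 2 * deriv z t / t)) (at t)"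
      using pos[OF t]
      by (auto intro!: derivative_eq_intros smooth_on_has_deriv2[OF assms(1,5) t]
          simp: power2_eq_square field_simps)
    then show ?thesis using ode[OF t] has_field_derivative_at_within by force
  qed
  from has_field_derivative_zero_constant[OF I this]
  obtain k where k: "\<And>t. t \<in> I \<Longrightarrow> t\<^sup>2 * deriv z t = k" by auto
  have "((\<lambda>t. z t + k / t) has_real_derivative 0) (at t within I)" if t: "t \<in> I" for t
  proof -
    have "((\<lambda>t. z t + k / t) has_real_derivative deriv z t - k / t\<^sup>2) (at t)"
      using pos[OF t]
      by (auto intro!: derivative_eq_intros smooth_on_has_deriv[OF assms(5) t]
          simp: power2_eq_square)
    moreover have "deriv z t - k / t\<^sup>2 = 0"
      using k[OF t] pos[OF t] by (auto simp: field_simps)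
    ultimately show ?thesis using has_field_derivative_at_within by force
  qed
  from has_field_derivative_zero_constant[OF I this]
  obtain z1 where "\<And>t. t \<in> I \<Longrightarrow> z t + k / t = z1" by auto
  then have "\<forall>t\<in>I. z t = (- k) / t + z1" by force
  then show ?thesis by blast
qed

theorem theorem9:
  fixes c :: real and I J :: "real set" and z :: "real \<Rightarrow> real"
  assumes "open I" "is_interval I" "I \<noteq> {}" "I \<subseteq> {0<..}"
    and "open J" "is_interval J" "J \<noteq> {}"
    and "smooth_on I z"
  shows "(singular_minimal_yz (helicoidal_surface c z) (I \<times> J) \<or>
          singular_minimal_xy (helicoidal_surface c z) (I \<times> J) \<longrightarrow>
            c = 0 \<and> is_revolution_surface (helicoidal_surface c z) (generating_curve z) I J) \<and>
         (singular_minimal_yz (helicoidal_surface c z) (I \<times> J) \<longrightarrow>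
            (\<exists>z1 z2. \<forall>t\<in>I. z t = z2 / t + z1)) \<and>
         (singular_minimal_xy (helicoidal_surface c z) (I \<times> J) \<longrightarrow>
            (\<forall>t\<in>I. z t > 0 \<and>
               deriv (deriv z) t + deriv z t / t = (1 - (deriv z t)\<^sup>2) / (2 * z t)))"
proof -
  note yz0 = singular_minimal_yz_pitch_zero[OF assms(1,3,4,5,7,8)]
  note xy0 = singular_minimal_xy_pitch_zero[OF assms(1,3,4,5,7,8)]
  obtain \<theta> where \<theta>: "\<theta> \<in> J" using assms(7) by blast
  have "is_revolution_surface (helicoidal_surface 0 z) (generating_curve z) I J"
    by (simp add: is_revolution_surface_def helicoidal_surface_def generating_curve_def rot_z_def
        mult.commute)
  moreover have "\<exists>z1 z2. \<forall>t\<in>I. z t = z2 / t + z1"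
    if sm: "singular_minimal_yz (helicoidal_surface c z) (I \<times> J)"
  proof (rule radial_harmonic_solution[OF assms(1-4,8)])
    fix t assume t: "t \<in> I"
    \<comment> \<open>Once \<open>c = 0\<close>, the equation at a single angle suffices, because
      its factor cos is nonzero.\<close>
    have "t * cos \<theta> > 0"
      using sm t \<theta> unfolding singular_minimal_yz_def
      by (fastforce simp: helicoidal_surface_def)
    then show "deriv (deriv z) t + 2 * deriv z t / t = 0"
      using singular_minimal_yz_helicoidal[OF assms(1,4,8) t \<theta> sm] yz0[OF sm] by auto
  qed
  moreover have "z t > 0 \<and>
      deriv (deriv z) t + deriv z t / t = (1 - (deriv z t)\<^sup>2) / (2 * z t)"
    if sm: "singular_minimal_xy (helicoidal_surface c z) (I \<times> J)" and t: "t \<in> I" for t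
    using singular_minimal_xy_helicoidal[OF assms(1,4,8) t \<theta> sm] xy0[OF sm]
    by (auto simp: eq_divide_eq algebra_simps)
  ultimately show ?thesis
    using yz0 xy0 by blast
qed

end
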